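(* Let $\mathbb{K} = \mathbb{R}$ or $\mathbb{C}$, let $U \subset \mathbb{K}^N$ be an open set, and let $(K_n)_{n \ge 0}$ be a sequence of compact sets such that $K_n \subset K_{n+1}$ for all $n \ge 0$ and $\bigcup_{n \ge 0} K_n = U$. Let $T : \mathcal{C}(U) \to \mathcal{C}(U)$ be a linear, continuous and surjective operator such that for all $f \in \mathcal{C}(U)$ and $n \ge 0$, \[ \|T(f)\|_{\infty,n} = \|f\|_{\infty,n}. \] Then there exist a continuous unimodular function $h$ on $U$ and a homeomorphism $\varphi$ from $U$ onto $U$ satisfying $\varphi(K_n) = K_n$ for all $n \ge 0$, such that for all $f \in \mathcal{C}(U)$ and $z \in U$, \[ T(f)(z) = h(z) f(\varphi(z)). \]
   Context: $\mathcal{C}(U)$ is the space of all continuous complex-valued functions on $U$, endowed with the supremum seminorms $\|f\|_{\infty,n} = \sup_{z \in K_n} |f(z)|$, $n \ge 0$. A function $h : U \to \mathbb{C}$ is unimodular if $|h(z)| = 1$ for all $z \in U$. *)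

theory Defs
  imports "HOL-Analysis.Analysis"
begin

(* Scalars: the types of sort {real_normed_field, euclidean_space} are, up to isometric
   isomorphism, exactly the reals and the complex numbers, so 'k ^ 'n with 'k of this sort
   is R^N or C^N. *)

(* A function on U is represented by its extension by 0 outside U.  This makes equality of
   elements of C(U) coincide with HOL equality and keeps C(U) closed under pointwise sums and
   scalar multiples. *)
definition cont_space :: "'a::topological_space set \<Rightarrow> ('a \<Rightarrow> complex) set" where
  "cont_space U = {f. continuous_on U f \<and> (\<forall>z. z \<notin> U \<longrightarrow> f z = 0)}"

(* The supremum over the empty set is 0 here; Sup {} is unspecified on the reals. *)
definition sup_seminorm :: "'a set \<Rightarrow> ('a \<Rightarrow> complex) \<Rightarrow> real" where
  "sup_seminorm A f = (if A = {} then 0 else (SUP z\<in>A. norm (f z)))"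

(* The locally convex topology on C(U) defined by the seminorms sup_seminorm (K n): the open
   seminorm balls form a subbase. *)
definition cont_space_topology ::
    "'a::topological_space set \<Rightarrow> (nat \<Rightarrow> 'a set) \<Rightarrow> ('a \<Rightarrow> complex) topology" where
  "cont_space_topology U K = topology_generated_by
     {{g \<in> cont_space U. sup_seminorm (K n) (\<lambda>z. g z - f z) < e} | f n e.
        f \<in> cont_space U \<and> 0 < e}"

lemma topspace_cont_space_topology: "topspace (cont_space_topology U K) = cont_space U"
proof -
  have "f \<in> {g \<in> cont_space U. sup_seminorm (K 0) (\<lambda>z. g z - f z) < 1}"
    if "f \<in> cont_space U" for f
    using that by (simp add: sup_seminorm_def)
  then have "cont_space U \<subseteq> \<Union>{{g \<in> cont_space U. sup_seminorm (K n) (\<lambda>z. g z - f z) < e} | f n e.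
        f \<in> cont_space U \<and> 0 < e}"
    using zero_less_one by blast
  then show ?thesis
    unfolding cont_space_topology_def topology_generated_by_topspace by blast
qed

definition complex_linear_on ::
    "('a \<Rightarrow> complex) set \<Rightarrow> (('a \<Rightarrow> complex) \<Rightarrow> ('a \<Rightarrow> complex)) \<Rightarrow> bool" where
  "complex_linear_on V T \<longleftrightarrow>
     (\<forall>f\<in>V. \<forall>g\<in>V. T (\<lambda>z. f z + g z) = (\<lambda>z. T f z + T g z)) \<and>
     (\<forall>c. \<forall>f\<in>V. T (\<lambda>z. c * f z) = (\<lambda>z. c * T f z))"

definition unimodular_on :: "'a set \<Rightarrow> ('a \<Rightarrow> complex) \<Rightarrow> bool" where
  "unimodular_on U h \<longleftrightarrow> (\<forall>z\<in>U. norm (h z) = 1)"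

end

theory Submission
  imports Defs
begin

text \<open>
  The idea is to find, for every point \<open>x\<close> of a compact set \<open>K\<close>, a point \<open>y\<close> of \<open>K\<close> where all the
  images of functions peaking at \<open>x\<close> have maximal modulus. Such functions are closed under
  midpoints, which makes \<open>y\<close> exist by compactness and forces all these images to take the same
  value at \<open>y\<close>. If \<open>g\<close> vanishes at \<open>x\<close> and \<open>|g| \<le> 1\<close> on \<open>K\<close>, then both \<open>1 - |g|\<close> and
  \<open>1 - |g| + g\<close> peak at \<open>x\<close>, so that \<open>T g\<close> vanishes at \<open>y\<close>. Hence evaluation at \<open>y\<close> after
  \<open>T\<close> is a multiple of evaluation at \<open>x\<close>. Applied to the inverse of \<open>T\<close>, this yields the map \<open>\<phi>\<close>,
  and applied to \<open>T\<close> its inverse \<open>\<psi>\<close>. Continuity of \<open>\<phi>\<close> holds because \<open>T f / T 1\<close> is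
  continuous for all \<open>f\<close>, whether or not the \<open>K n\<close> exhaust \<open>U\<close> in the sense that every compact
  subset is contained in one of them.
\<close>

section \<open>The function space: closure properties and separation of points\<close>

lemma cont_spaceI:
  assumes "continuous_on U f"
  shows "(\<lambda>z. if z \<in> U then f z else 0) \<in> cont_space U"
proof -
  have "continuous_on U (\<lambda>z. if z \<in> U then f z else 0)"
    using assms by (rule continuous_on_eq) simp
  then show ?thesis
    by (simp add: cont_space_def)
qed

text \<open>The indicator of \<open>U\<close> serves as the constant function 1, because members of
  \<open>cont_space U\<close> vanish outside \<open>U\<close>. Its image under \<open>T\<close>
  becomes the weight \<open>h\<close>.\<close>

lemma indicator_in_cont_space: "indicator U \<in> cont_space U"
proof -
  have "continuous_on U (indicator U :: _ \<Rightarrow> complex)"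
    by (rule continuous_on_eq[where f="\<lambda>_. 1"]) auto
  then show ?thesis
    by (simp add: cont_space_def)
qed

lemma cont_space_add:
  "f \<in> cont_space U \<Longrightarrow> g \<in> cont_space U \<Longrightarrow> (\<lambda>z. f z + g z) \<in> cont_space U"
  by (auto simp: cont_space_def intro!: continuous_intros)

lemma cont_space_cmul: "f \<in> cont_space U \<Longrightarrow> (\<lambda>z. c * f z) \<in> cont_space U"
  by (auto simp: cont_space_def intro!: continuous_intros)

lemma cont_space_diff:
  "f \<in> cont_space U \<Longrightarrow> g \<in> cont_space U \<Longrightarrow> (\<lambda>z. f z - g z) \<in> cont_space U"
  by (auto simp: cont_space_def intro!: continuous_intros)

text \<open>The distance to \<open>x\<close>, cut off outside \<open>U\<close>, is zero at
  \<open>x\<close> and at no other point of \<open>U\<close>.\<close>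

lemma cont_space_separates:
  fixes x y :: "'a::metric_space"
  assumes "x \<in> U" "y \<in> U" and eq: "\<And>f. f \<in> cont_space U \<Longrightarrow> f x = f y"
  shows "x = y"
proof -
  have "(\<lambda>z. if z \<in> U then complex_of_real (dist z x) else 0) \<in> cont_space U"
    by (intro cont_spaceI continuous_intros)
  from eq[OF this] assms show ?thesis
    by simp
qed

lemma complex_linear_onD:
  assumes "complex_linear_on (cont_space U) T" "f \<in> cont_space U" "g \<in> cont_space U"
  shows "T (\<lambda>z. f z + g z) = (\<lambda>z. T f z + T g z)"
    and "T (\<lambda>z. c * f z) = (\<lambda>z. c * T f z)"
    and "T (\<lambda>z. f z - g z) = (\<lambda>z. T f z - T g z)"
proof -
  have add: "T (\<lambda>z. f z + g z) = (\<lambda>z. T f z + T g z)"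
    if "f \<in> cont_space U" "g \<in> cont_space U" for f g
    using assms(1) that by (simp add: complex_linear_on_def)
  have cmul: "T (\<lambda>z. c * f z) = (\<lambda>z. c * T f z)" if "f \<in> cont_space U" for c f
    using assms(1) that by (simp add: complex_linear_on_def)
  show "T (\<lambda>z. f z + g z) = (\<lambda>z. T f z + T g z)"
    and "T (\<lambda>z. c * f z) = (\<lambda>z. c * T f z)"
    using add cmul assms(2,3) by blast+
  show "T (\<lambda>z. f z - g z) = (\<lambda>z. T f z - T g z)"
    using add[OF assms(2) cont_space_cmul[OF assms(3), of "-1"]] cmul[OF assms(3), of "-1"]
    by simp
qed

section \<open>Supremum seminorms over compact sets\<close>

lemma norm_le_sup_seminorm:
  assumes "compact K" "continuous_on K f" "z \<in> K"
  shows "norm (f z) \<le> sup_seminorm K f"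
proof -
  have "bdd_above ((\<lambda>z. norm (f z)) ` K)"
    using assms by (intro bounded_imp_bdd_above compact_imp_bounded compact_continuous_image
        continuous_intros)
  then show ?thesis
    using assms by (auto simp: sup_seminorm_def intro: cSUP_upper)
qed

lemma sup_seminorm_attained:
  assumes "compact K" "continuous_on K f" "K \<noteq> {}"
  shows "\<exists>z\<in>K. norm (f z) = sup_seminorm K f"
proof -
  obtain z where z: "z \<in> K" "\<And>w. w \<in> K \<Longrightarrow> norm (f w) \<le> norm (f z)"
    using continuous_attains_sup[of K "\<lambda>z. norm (f z)"] assms by (auto intro: continuous_intros)
  then have "sup_seminorm K f \<le> norm (f z)"
    using assms by (auto simp: sup_seminorm_def intro: cSUP_least)
  with z show ?thesis
    using norm_le_sup_seminorm[OF assms(1,2)] by (intro bexI[of _ z] antisym)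
qed

text \<open>Strict convexity of the disc: the triangle inequality forces both norms to be 1, and the
  parallelogram law then leaves no room for \<open>a - b\<close>.\<close>

lemma midpoint_norm_one:
  fixes a b :: complex
  assumes "norm a \<le> 1" "norm b \<le> 1" "norm (1/2 * (a + b)) = 1"
  shows "norm a = 1" and "norm b = 1" and "a = b"
proof -
  have ab: "norm (a + b) = 2"
    using assms(3) by (simp add: norm_mult norm_divide)
  show a: "norm a = 1" and b: "norm b = 1"
    using norm_triangle_ineq[of a b] ab assms by linarith+
  have "(norm (a + b))\<^sup>2 + (norm (a - b))\<^sup>2 = 2 * (norm a)\<^sup>2 + 2 * (norm b)\<^sup>2"
    unfolding cmod_power2 by (simp add: power2_eq_square algebra_simps)
  then show "a = b"
    using a b ab by simp
qed

section \<open>Peaking functions and point evaluations\<close>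

lemma isometry_point_evaluation:
  fixes U :: "'a::t2_space set"
  assumes K: "compact K" "K \<subseteq> U" "x \<in> K"
    and lin: "complex_linear_on (cont_space U) T"
    and into: "\<And>f. f \<in> cont_space U \<Longrightarrow> T f \<in> cont_space U"
    and iso: "\<And>f. f \<in> cont_space U \<Longrightarrow> sup_seminorm K (T f) = sup_seminorm K f"
  shows "\<exists>y\<in>K. norm (T (indicator U) y) = 1 \<and>
    (\<forall>f\<in>cont_space U. T f y = T (indicator U) y * f x)"
proof -
  \<comment> \<open>\<open>P\<close> collects the functions peaking at \<open>x\<close>. They have
    seminorm 1 on \<open>K\<close>, so for them \<open>A f\<close> is the set where
    \<open>T f\<close> attains its maximal modulus over \<open>K\<close>.\<close>
  define P where "P = {f \<in> cont_space U. f x = 1 \<and> (\<forall>z\<in>K. norm (f z) \<le> 1)}"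
  define A where "A f = {y \<in> K. norm (T f y) = 1}" for f
  have cont: "continuous_on K f" if "f \<in> cont_space U" for f
    using that K(2) by (auto simp: cont_space_def intro: continuous_on_subset)
  have P_norm: "sup_seminorm K (T f) = 1" if "f \<in> P" for f
  proof -
    have "sup_seminorm K f \<le> 1"
      using that K by (auto simp: P_def sup_seminorm_def intro: cSUP_least)
    moreover have "norm (f x) \<le> sup_seminorm K f"
      using that K by (intro norm_le_sup_seminorm cont) (auto simp: P_def)
    ultimately show ?thesis
      using that iso by (simp add: P_def)
  qed
  have P_le: "norm (T f y) \<le> 1" if "f \<in> P" "y \<in> K" for f y
    using norm_le_sup_seminorm[of K "T f" y] that P_norm[of f] K cont into
    by (simp add: P_def)
  have A_ne: "A f \<noteq> {}" if "f \<in> P" for f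
    using sup_seminorm_attained[of K "T f"] that P_norm[of f] K cont into
    by (auto simp: P_def A_def)
  define m where "m f g = (\<lambda>z. 1/2 * (f z + g z))" for f g :: "'a \<Rightarrow> complex"
  have m_P: "m f g \<in> P" if "f \<in> P" "g \<in> P" for f g
  proof -
    have "norm (m f g z) \<le> 1" if "z \<in> K" for z
    proof -
      have "norm (f z + g z) \<le> 2"
        using norm_triangle_ineq[of "f z" "g z"] \<open>f \<in> P\<close> \<open>g \<in> P\<close> that
        by (fastforce simp: P_def)
      then show ?thesis
        by (simp add: m_def norm_mult norm_divide)
    qed
    moreover have "m f g \<in> cont_space U"
      using that unfolding m_def by (intro cont_space_cmul cont_space_add) (auto simp: P_def)
    ultimately show ?thesis
      using that by (auto simp: P_def m_def)
  qed
  have T_m: "T (m f g) = m (T f) (T g)" if "f \<in> P" "g \<in> P" for f g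
  proof -
    have fg: "f \<in> cont_space U" "g \<in> cont_space U" "(\<lambda>z. f z + g z) \<in> cont_space U"
      using that by (auto simp: P_def intro: cont_space_add)
    show ?thesis
      unfolding m_def complex_linear_onD(2)[OF lin fg(3) fg(3)] complex_linear_onD(1)[OF lin fg(1,2)] ..
  qed
  \<comment> \<open>\<open>T\<close> commutes with midpoints, so strict convexity applies to the
    values at \<open>y\<close>: it gives membership in both sets and equality of the two values at
    once.\<close>
  have A_m: "y \<in> A f \<and> y \<in> A g \<and> T f y = T g y" if "f \<in> P" "g \<in> P" "y \<in> A (m f g)" for f g y
  proof -
    have y: "y \<in> K" "norm (1/2 * (T f y + T g y)) = 1"
      using that T_m[of f g] by (auto simp: A_def m_def)
    show ?thesis
      using midpoint_norm_one[OF P_le P_le y(2)] that y by (simp add: A_def)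
  qed
  have one_P: "indicator U \<in> P"
    using K indicator_in_cont_space by (auto simp: P_def indicator_def)
  \<comment> \<open>Iterated midpoints give one peaking function whose set lies in all of the
    finitely many given ones. As this set is nonempty, the finite intersection property
    follows.\<close>
  have A_fin: "\<exists>f\<in>P. A f \<subseteq> (\<Inter>g\<in>F. A g)" if "finite F" "F \<subseteq> P" for F
    using that
  proof (induction F)
    case empty
    then show ?case
      using one_P by auto
  next
    case (insert g F)
    then obtain f where f: "f \<in> P" "A f \<subseteq> (\<Inter>g\<in>F. A g)"
      by auto
    have "A (m g f) \<subseteq> A g \<inter> A f"
      using A_m[of g f] insert f by blast
    with f have "A (m g f) \<subseteq> (\<Inter>h\<in>insert g F. A h)"
      by auto
    then show ?case
      using m_P[of g f] f insert by blast
  qed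
  have "K \<inter> (\<Inter>f\<in>P. A f) \<noteq> {}"
  proof (rule compact_imp_fip_image[OF K(1)])
    show "closed (A f)" if "f \<in> P" for f
    proof -
      have "continuous_on K (\<lambda>y. norm (T f y))"
        using that cont into by (intro continuous_intros) (auto simp: P_def)
      then have "closed (K \<inter> (\<lambda>y. norm (T f y)) -` {1})"
        using compact_imp_closed[OF K(1)] by (intro continuous_closed_preimage) auto
      also have "K \<inter> (\<lambda>y. norm (T f y)) -` {1} = A f"
        by (auto simp: A_def)
      finally show ?thesis .
    qed
  next
    fix F assume "finite F" "F \<subseteq> P"
    from A_fin[OF this] obtain f where f: "f \<in> P" "A f \<subseteq> (\<Inter>g\<in>F. A g)"
      by blast
    moreover have "A f \<subseteq> K"
      by (auto simp: A_def)
    ultimately show "K \<inter> (\<Inter>g\<in>F. A g) \<noteq> {}"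
      using A_ne[of f] by blast
  qed
  then obtain y where y: "y \<in> K" "\<And>f. f \<in> P \<Longrightarrow> y \<in> A f"
    by auto
  have P_eq: "T f y = T g y" if "f \<in> P" "g \<in> P" for f g
    using A_m[OF that y(2)[OF m_P[OF that]]] by simp
  have vanish: "T g y = 0" if g: "g \<in> cont_space U" "g x = 0" for g
  proof -
    \<comment> \<open>The summand 1 keeps \<open>c\<close> positive even if \<open>g\<close>
      vanishes on \<open>K\<close>; dividing by \<open>c\<close> brings \<open>g\<close> into the
      unit disc on \<open>K\<close>.\<close>
    define c where "c = sup_seminorm K g + 1"
    have c: "norm (g z) \<le> c" if "z \<in> K" for z
      using norm_le_sup_seminorm[OF K(1) cont[OF g(1)] that] by (simp add: c_def)
    have c_pos: "c > 0"
      using norm_le_sup_seminorm[OF K(1) cont[OF g(1)] K(3)] norm_ge_zero[of "g x"]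
      unfolding c_def by linarith
    define u where "u = (\<lambda>z. 1 / complex_of_real c * g z)"
    \<comment> \<open>Both \<open>f\<close> and \<open>f + u\<close> are 1 at \<open>x\<close>, and
      on \<open>K\<close> the modulus of \<open>f + u\<close> is at most
      \<open>(1 - norm (u z)) + norm (u z)\<close>. Outside \<open>K\<close> the values may be
      large, but \<open>P\<close> bounds them on \<open>K\<close> only.\<close>
    define f where "f = (\<lambda>z. if z \<in> U then 1 - complex_of_real (norm (u z)) else 0)"
    have u: "u \<in> cont_space U"
      unfolding u_def using g by (intro cont_space_cmul)
    have u_le: "norm (u z) \<le> 1" if "z \<in> K" for z
      using c[OF that] c_pos by (simp add: u_def norm_mult norm_divide)
    have f: "f \<in> cont_space U"
      using u unfolding f_def by (intro cont_spaceI continuous_intros) (simp add: cont_space_def)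
    have f_norm: "norm (f z) = 1 - norm (u z)" if "z \<in> K" for z
    proof -
      have "f z = complex_of_real (1 - norm (u z))"
        using that K by (auto simp: f_def)
      then show ?thesis
        using u_le[OF that] by (simp only: norm_of_real)
    qed
    have "f \<in> P"
      using f f_norm K g by (auto simp: P_def f_def u_def)
    moreover have "(\<lambda>z. f z + u z) \<in> P"
    proof -
      have "norm (f z + u z) \<le> 1" if "z \<in> K" for z
        using norm_triangle_ineq[of "f z" "u z"] f_norm[OF that] by simp
      then show ?thesis
        using f u K g by (auto simp: P_def f_def u_def intro: cont_space_add)
    qed
    ultimately have "T f y = T (\<lambda>z. f z + u z) y"
      by (rule P_eq)
    also have "\<dots> = T f y + 1 / complex_of_real c * T g y"
      unfolding complex_linear_onD(1)[OF lin f u]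
      unfolding u_def complex_linear_onD(2)[OF lin g(1) g(1)] ..
    finally show ?thesis
      using c_pos by simp
  qed
  show ?thesis
  proof (intro bexI[of _ y] conjI ballI)
    show "y \<in> K" "norm (T (indicator U) y) = 1"
      using y(1) y(2)[OF one_P] by (auto simp: A_def)
    fix f assume f: "f \<in> cont_space U"
    \<comment> \<open>Subtracting the constant \<open>f x\<close> yields a function that vanishes at
      \<open>x\<close>.\<close>
    let ?c = "\<lambda>z. f x * indicator U z"
    have c: "?c \<in> cont_space U"
      by (intro cont_space_cmul indicator_in_cont_space)
    have "T (\<lambda>z. f z - ?c z) y = 0"
      using K by (intro vanish cont_space_diff f c) auto
    then show "T f y = T (indicator U) y * f x"
      using complex_linear_onD(3)[OF lin f c]
        complex_linear_onD(2)[OF lin indicator_in_cont_space indicator_in_cont_space, of "f x"]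
      by simp
  qed
qed

section \<open>From point evaluations to a continuous weighted composition\<close>

text \<open>The point evaluation lemma is applied to \<open>S\<close> because it sends the point of
  evaluation of the argument to that of the image. For \<open>S\<close> it turns \<open>z\<close>
  into some \<open>x\<close> with \<open>S f x = c * f z\<close>; inserting \<open>T f\<close> for
  \<open>f\<close> gives \<open>f x = c * T f z\<close>, which is solved for
  \<open>T f z\<close>.\<close>

lemma isometry_weighted_composition:
  fixes U :: "'a::metric_space set" and K :: "nat \<Rightarrow> 'a set"
  assumes K: "\<And>n. compact (K n)" "(\<Union>n. K n) = U"
    and T_into: "\<And>f. f \<in> cont_space U \<Longrightarrow> T f \<in> cont_space U"
    and S_into: "\<And>f. f \<in> cont_space U \<Longrightarrow> S f \<in> cont_space U"
    and ST: "\<And>f. f \<in> cont_space U \<Longrightarrow> S (T f) = f"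
    and S_lin: "complex_linear_on (cont_space U) S"
    and S_iso: "\<And>f n. f \<in> cont_space U \<Longrightarrow> sup_seminorm (K n) (S f) = sup_seminorm (K n) f"
  shows "\<exists>\<phi>. continuous_on U \<phi> \<and> (\<forall>n. \<phi> ` K n \<subseteq> K n) \<and>
    unimodular_on U (T (indicator U)) \<and>
    (\<forall>f\<in>cont_space U. \<forall>z\<in>U. T f z = T (indicator U) z * f (\<phi> z))"
proof -
  let ?h = "T (indicator U)"
  define R where "R z x \<longleftrightarrow> x \<in> U \<and> norm (?h z) = 1 \<and> (\<forall>f\<in>cont_space U. T f z = ?h z * f x)" for z x
  have ex: "\<exists>x\<in>K n. R z x" if z: "z \<in> K n" for n z
  proof -
    have KU: "K n \<subseteq> U"
      using K(2) by blast
    obtain x where x: "x \<in> K n" "norm (S (indicator U) x) = 1"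
      "\<And>f. f \<in> cont_space U \<Longrightarrow> S f x = S (indicator U) x * f z"
      using isometry_point_evaluation[OF K(1) KU z S_lin S_into S_iso] by metis
    let ?c = "S (indicator U) x"
    have f_x: "f x = ?c * T f z" if "f \<in> cont_space U" for f
      using x(3)[OF T_into[OF that]] ST[OF that] by simp
    have xU: "x \<in> U"
      using x(1) KU by blast
    then have c: "?c * ?h z = 1"
      using f_x[OF indicator_in_cont_space] by simp
    then have "norm (?c * ?h z) = 1"
      by (metis norm_one)
    then have "norm (?h z) = 1"
      using x(2) by (simp add: norm_mult)
    moreover have "T f z = ?h z * f x" if "f \<in> cont_space U" for f
      unfolding f_x[OF that] using c by (metis mult.assoc mult.commute mult_1)
    ultimately show ?thesis
      using x xU by (auto simp: R_def)
  qed
  \<comment> \<open>The point \<open>x\<close> was found inside a particular \<open>K n\<close>.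
    Uniqueness makes it independent of \<open>n\<close>, so a single map preserves every
    \<open>K n\<close>.\<close>
  have unique: "x = x'" if "R z x" "R z x'" for z x x'
  proof (rule cont_space_separates)
    show "x \<in> U" "x' \<in> U"
      using that by (auto simp: R_def)
    show "f x = f x'" if "f \<in> cont_space U" for f
    proof -
      have "?h z * f x = ?h z * f x'" "?h z \<noteq> 0"
        using \<open>R z x\<close> \<open>R z x'\<close> that by (auto simp: R_def)
      then show ?thesis
        by simp
    qed
  qed
  define \<phi> where "\<phi> z = (THE x. R z x)" for z
  have \<phi>: "\<phi> z = x" if "R z x" for z x
    unfolding \<phi>_def using that unique by blast
  have R: "R z (\<phi> z)" if "z \<in> U" for z
    using that K(2) ex \<phi> by blast
  have h_cont: "continuous_on U ?h"
    using T_into[OF indicator_in_cont_space] by (simp add: cont_space_def)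
  have h_nz: "?h z \<noteq> 0" if "z \<in> U" for z
  proof -
    have "norm (?h z) = 1"
      using R[OF that] unfolding R_def by blast
    then show ?thesis
      by force
  qed
  have comp: "continuous_on U (\<lambda>z. f (\<phi> z))" if f: "f \<in> cont_space U" for f
  proof (rule continuous_on_eq)
    show "continuous_on U (\<lambda>z. T f z / ?h z)"
    proof (rule continuous_on_divide[OF _ h_cont])
      show "continuous_on U (T f)"
        using T_into[OF f] by (simp add: cont_space_def)
    qed (simp add: h_nz)
    show "T f z / ?h z = f (\<phi> z)" if "z \<in> U" for z
    proof -
      have "T f z = ?h z * f (\<phi> z)"
        using R[OF that] f unfolding R_def by blast
      then show ?thesis
        using h_nz[OF that] by simp
    qed
  qed
  have \<phi>_U: "\<phi> z \<in> U" if "z \<in> U" for z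
    using R[OF that] by (simp add: R_def)
  have \<phi>_cont: "continuous_on U \<phi>"
    unfolding continuous_on_def
  proof
    fix z assume z: "z \<in> U"
    \<comment> \<open>Composition with \<open>\<phi>\<close> keeps members of
      \<open>cont_space U\<close> continuous on \<open>U\<close>; the distance to
      \<open>\<phi> z\<close> is the one that tests continuity of \<open>\<phi>\<close> at
      \<open>z\<close>.\<close>
    let ?d = "\<lambda>w. if w \<in> U then complex_of_real (dist w (\<phi> z)) else 0"
    have "continuous_on U (\<lambda>w. ?d (\<phi> w))"
      by (intro comp cont_spaceI continuous_intros)
    then have "continuous_on U (\<lambda>w. norm (?d (\<phi> w)))"
      by (intro continuous_intros)
    then have "continuous_on U (\<lambda>w. dist (\<phi> w) (\<phi> z))"
      by (rule continuous_on_eq) (simp add: \<phi>_U)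
    then have "((\<lambda>w. dist (\<phi> w) (\<phi> z)) \<longlongrightarrow> 0) (at z within U)"
      using z by (auto simp: continuous_on_def)
    then show "(\<phi> \<longlongrightarrow> \<phi> z) (at z within U)"
      by (rule tendsto_dist_iff[THEN iffD2])
  qed
  have "\<phi> ` K n \<subseteq> K n" for n
  proof
    fix w assume "w \<in> \<phi> ` K n"
    then obtain z x where z: "w = \<phi> z" and x: "x \<in> K n" "R z x"
      using ex by blast
    show "w \<in> K n"
      using \<phi>[OF x(2)] x(1) z by simp
  qed
  moreover have "unimodular_on U ?h"
    unfolding unimodular_on_def using R R_def by blast
  moreover have "T f z = ?h z * f (\<phi> z)" if "f \<in> cont_space U" "z \<in> U" for f z
    using R[OF that(2)] that(1) unfolding R_def by blast
  ultimately show ?thesis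
    using \<phi>_cont by blast
qed

text \<open>Expanding \<open>T (S f) = f\<close> gives \<open>f z\<close> as a weight times
  \<open>f (\<psi> (\<phi> z))\<close>. The constant function 1 shows that the weight is 1, and
  points are separated by \<open>cont_space U\<close>.\<close>

lemma inverse_weighted_composition:
  fixes U :: "'a::metric_space set"
  assumes T: "\<And>f z. f \<in> cont_space U \<Longrightarrow> z \<in> U \<Longrightarrow> T f z = h z * f (\<phi> z)"
    and S: "\<And>f z. f \<in> cont_space U \<Longrightarrow> z \<in> U \<Longrightarrow> S f z = k z * f (\<psi> z)"
    and S_into: "\<And>f. f \<in> cont_space U \<Longrightarrow> S f \<in> cont_space U"
    and TS: "\<And>f. f \<in> cont_space U \<Longrightarrow> T (S f) = f"
    and maps: "\<phi> ` U \<subseteq> U" "\<psi> ` U \<subseteq> U"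
    and z: "z \<in> U"
  shows "\<psi> (\<phi> z) = z"
proof -
  have eq: "f z = h z * k (\<phi> z) * f (\<psi> (\<phi> z))" if "f \<in> cont_space U" for f
    using T[OF S_into[OF that] z] S[OF that, of "\<phi> z"] TS[OF that] maps z by auto
  have "h z * k (\<phi> z) = 1"
    using eq[OF indicator_in_cont_space] maps z by (auto simp: image_subset_iff)
  then have "f z = f (\<psi> (\<phi> z))" if "f \<in> cont_space U" for f
    using eq[OF that] by simp
  moreover have "\<psi> (\<phi> z) \<in> U"
    using maps z by blast
  ultimately show ?thesis
    using cont_space_separates[OF z] by metis
qed

section \<open>The inverse operator and the homeomorphism\<close>

theorem theorem3p11:
  fixes U :: "('k::{real_normed_field, euclidean_space} ^ 'n) set"
    and K :: "nat \<Rightarrow> ('k ^ 'n) set"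
    and T :: "('k ^ 'n \<Rightarrow> complex) \<Rightarrow> ('k ^ 'n \<Rightarrow> complex)"
  assumes "open U"
    and "\<And>n. compact (K n)"
    and "\<And>n. K n \<subseteq> K (Suc n)"
    and "(\<Union>n. K n) = U"
    and "complex_linear_on (cont_space U) T"
    and "continuous_map (cont_space_topology U K) (cont_space_topology U K) T"
    and "T ` cont_space U = cont_space U"
    and "\<And>f n. f \<in> cont_space U \<Longrightarrow> sup_seminorm (K n) (T f) = sup_seminorm (K n) f"
  shows "\<exists>h \<phi> \<psi>. continuous_on U h \<and> unimodular_on U h \<and>
           homeomorphism U U \<phi> \<psi> \<and> (\<forall>n. \<phi> ` K n = K n) \<and>
           (\<forall>f\<in>cont_space U. \<forall>z\<in>U. T f z = h z * f (\<phi> z))"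
proof -
  let ?V = "cont_space U"
  note K = assms(2,4) and lin = assms(5) and iso = assms(8)
  have T_into: "T f \<in> ?V" if "f \<in> ?V" for f
    using assms(7) that by blast
  have inj: "inj_on T ?V"
  proof (rule inj_onI)
    fix f g assume fg: "f \<in> ?V" "g \<in> ?V" and eq: "T f = T g"
    have d: "(\<lambda>z. f z - g z) \<in> ?V"
      using fg by (rule cont_space_diff)
    have "f z = g z" if "z \<in> K n" for n z
    proof -
      have "norm (f z - g z) \<le> sup_seminorm (K n) (\<lambda>z. f z - g z)"
        using d K that by (intro norm_le_sup_seminorm[where f="\<lambda>z. f z - g z"])
          (auto simp: cont_space_def intro: continuous_on_subset)
      also have "\<dots> = sup_seminorm (K n) (T (\<lambda>z. f z - g z))"
        using iso[OF d] by simp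
      also have "\<dots> = 0"
        using complex_linear_onD(3)[OF lin fg] eq by (simp add: sup_seminorm_def)
      finally show ?thesis
        by simp
    qed
    then have "f z = g z" for z
      using fg K(2) by (cases "z \<in> U") (auto simp: cont_space_def)
    then show "f = g" ..
  qed
  \<comment> \<open>The inverse of \<open>T\<close> on \<open>cont_space U\<close>; it inherits
    linearity and all the seminorm identities, so the representation applies to both
    operators.\<close>
  define S where "S = inv_into ?V T"
  have ST: "S (T f) = f" if "f \<in> ?V" for f
    using inj that by (simp add: S_def)
  have TS: "T (S f) = f" if "f \<in> ?V" for f
    using assms(7) that by (simp add: S_def f_inv_into_f)
  have S_into: "S f \<in> ?V" if "f \<in> ?V" for f
    using assms(7) that by (simp add: S_def inv_into_into)
  have S_iso: "sup_seminorm (K n) (S f) = sup_seminorm (K n) f" if "f \<in> ?V" for f n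
    using iso[OF S_into[OF that]] TS[OF that] by simp
  have S_lin: "complex_linear_on ?V S"
    unfolding complex_linear_on_def
  proof (intro conjI ballI allI)
    fix f g assume fg: "f \<in> ?V" "g \<in> ?V"
    note s = S_into[OF fg(1)] S_into[OF fg(2)]
    show "S (\<lambda>z. f z + g z) = (\<lambda>z. S f z + S g z)"
      using ST[OF cont_space_add[OF s]] complex_linear_onD(1)[OF lin s] TS fg by simp
  next
    fix c f assume f: "f \<in> ?V"
    note s = S_into[OF f]
    show "S (\<lambda>z. c * f z) = (\<lambda>z. c * S f z)"
      using ST[OF cont_space_cmul[OF s]] complex_linear_onD(2)[OF lin s s] TS[OF f] by simp
  qed
  obtain \<phi> where \<phi>: "continuous_on U \<phi>" "\<And>n. \<phi> ` K n \<subseteq> K n"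
    "unimodular_on U (T (indicator U))"
    "\<And>f z. f \<in> ?V \<Longrightarrow> z \<in> U \<Longrightarrow> T f z = T (indicator U) z * f (\<phi> z)"
    using isometry_weighted_composition[OF K T_into S_into ST S_lin S_iso] by metis
  obtain \<psi> where \<psi>: "continuous_on U \<psi>" "\<And>n. \<psi> ` K n \<subseteq> K n"
    "\<And>f z. f \<in> ?V \<Longrightarrow> z \<in> U \<Longrightarrow> S f z = S (indicator U) z * f (\<psi> z)"
    using isometry_weighted_composition[OF K S_into T_into TS lin iso] by metis
  have maps: "\<phi> ` U \<subseteq> U" "\<psi> ` U \<subseteq> U"
    using \<phi>(2) \<psi>(2) K(2) by blast+
  have \<psi>\<phi>: "\<psi> (\<phi> z) = z" if "z \<in> U" for z
    using inverse_weighted_composition[OF \<phi>(4) \<psi>(3) S_into TS maps that] by blast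
  have \<phi>\<psi>: "\<phi> (\<psi> z) = z" if "z \<in> U" for z
    using inverse_weighted_composition[OF \<psi>(3) \<phi>(4) T_into ST maps(2,1) that] by blast
  have "homeomorphism U U \<phi> \<psi>"
    using \<phi>(1) \<psi>(1) maps \<psi>\<phi> \<phi>\<psi> by (intro homeomorphismI)
  moreover have "\<phi> ` K n = K n" for n
  proof
    \<comment> \<open>Equality comes from \<open>\<psi>\<close>, which also maps \<open>K n\<close>
      into itself and thus supplies preimages inside \<open>K n\<close>.\<close>
    show "K n \<subseteq> \<phi> ` K n"
    proof
      fix x assume x: "x \<in> K n"
      then have "\<phi> (\<psi> x) = x" "\<psi> x \<in> K n"
        using \<phi>\<psi> \<psi>(2) K(2) by blast+
      then show "x \<in> \<phi> ` K n"
        by (metis imageI)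
    qed
  qed (rule \<phi>(2))
  moreover have "continuous_on U (T (indicator U))"
    using T_into[OF indicator_in_cont_space] by (simp add: cont_space_def)
  ultimately show ?thesis
    using \<phi>(3,4) by blast
qed

end
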